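(* For every $n\ge1$, the B-code is a bijection from $B_n$ to $\mathrm{SE}^{\mathrm B}_n$, and for every $\sigma\in B_n$, $$\mathrm{Cyc_B}\,\sigma=\mathrm{Max}(\text{B-code}\,\sigma)\qquad\text{and}\qquad \mathrm{Lmap_B}\,\sigma=\mathrm{Rmil_B}(\text{B-code}\,\sigma).$$
   Context: $B_n$ is the group of bijections $\sigma$ of $\{\pm1,\ldots,\pm n\}$ with $\sigma(-i)=-\sigma(i)$, written $\sigma_1\cdots\sigma_n$ with $\sigma_i=\sigma(i)$. The B-code of $\sigma$ is $(b_1,\ldots,b_n)$ where $k_i$ is the smallest integer $k\ge1$ with $|\sigma^{-k}(i)|\le i$ and $b_i=\sigma^{-k_i}(i)$. $\mathrm{SE}^{\mathrm B}_n$ is the set of integer sequences $(a_1,\ldots,a_n)$ with $a_i\in[-i,i]\setminus\{0\}$, and $\mathrm{Max}\,a=\{i:a_i=i\}$. Let $|\sigma|$ be the permutation of $[n]$ with $|\sigma|(i)=|\sigma(i)|$; a cycle $C$ of $|\sigma|$ is balanced if the number of $i\in C$ with $\sigma(i)<0$ is even. $\mathrm{Cyc_B}\,\sigma$ is the set of minimal elements of the balanced cycles of $|\sigma|$. For an integer word $\omega=\omega_1\cdots\omega_n$: $\mathrm{Lmap_B}\,\omega=\{i:\omega_i>|\omega_j|\ \forall j<i\}$, $\mathrm{Rmil_B}\,\omega=\{\omega_i:0<\omega_i<|\omega_j|\ \forall j>i\}$ (applied to $\sigma$ via its word $\sigma_1\cdots\sigma_n$, and to codes as words).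
   Formalization: Lmap_B is taken with the extra condition ω_i > 0 (convention ω_0 = 0), which only excludes i = 1 when the first letter is negative; without it the claim fails, e.g. for n = 1, σ = (−1), where Lmap_B σ = {1} but Rmil_B of the code is empty. *)

theory Defs
  imports "HOL-Combinatorics.Combinatorics" "HOL-Library.FuncSet"
begin

text \<open>
  Elements of the group of signed permutations are functions on all integers that fix every
  integer outside \<open>{\<plusminus>1, \<dots>, \<plusminus>n}\<close>. Words and sequences of length \<open>n\<close> are functions on the index
  set \<open>{1..int n}\<close>, taking the value \<open>undefined\<close> outside it.
\<close>

definition signed_perms :: "nat \<Rightarrow> (int \<Rightarrow> int) set" where
  "signed_perms n = {\<sigma>. \<sigma> permutes ({- int n..int n} - {0}) \<and>
     (\<forall>i \<in> {- int n..int n} - {0}. \<sigma> (- i) = - \<sigma> i)}"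

definition word :: "nat \<Rightarrow> (int \<Rightarrow> int) \<Rightarrow> int \<Rightarrow> int" where
  "word n \<sigma> = restrict \<sigma> {1..int n}"

definition SE_B :: "nat \<Rightarrow> (int \<Rightarrow> int) set" where
  "SE_B n = (\<Pi>\<^sub>E i \<in> {1..int n}. {- i..i} - {0})"

definition code_exponent :: "(int \<Rightarrow> int) \<Rightarrow> int \<Rightarrow> nat" where
  "code_exponent \<sigma> i = (LEAST k. k \<ge> 1 \<and> \<bar>(inv \<sigma> ^^ k) i\<bar> \<le> i)"

definition B_code :: "nat \<Rightarrow> (int \<Rightarrow> int) \<Rightarrow> int \<Rightarrow> int" where
  "B_code n \<sigma> = (\<lambda>i \<in> {1..int n}. (inv \<sigma> ^^ code_exponent \<sigma> i) i)"

definition Max_set :: "nat \<Rightarrow> (int \<Rightarrow> int) \<Rightarrow> int set" where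
  "Max_set n a = {i \<in> {1..int n}. a i = i}"

definition abs_perm :: "nat \<Rightarrow> (int \<Rightarrow> int) \<Rightarrow> int \<Rightarrow> int" where
  "abs_perm n \<sigma> i = (if i \<in> {1..int n} then \<bar>\<sigma> i\<bar> else i)"

text \<open>
  A cycle is identified with its underlying set, an orbit; fixed points contribute cycles of
  length one.
\<close>

definition abs_cycles :: "nat \<Rightarrow> (int \<Rightarrow> int) \<Rightarrow> int set set" where
  "abs_cycles n \<sigma> = orbit (abs_perm n \<sigma>) ` {1..int n}"

definition balanced :: "(int \<Rightarrow> int) \<Rightarrow> int set \<Rightarrow> bool" where
  "balanced \<sigma> C \<longleftrightarrow> even (card {i \<in> C. \<sigma> i < 0})"

definition Cyc_B :: "nat \<Rightarrow> (int \<Rightarrow> int) \<Rightarrow> int set" where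
  "Cyc_B n \<sigma> = Min ` {C \<in> abs_cycles n \<sigma>. balanced \<sigma> C}"

text \<open>
  The condition \<open>0 < \<omega> i\<close> is the usual convention \<open>\<omega> 0 = 0\<close>. It follows from the condition on
  \<open>j < i\<close> unless \<open>i = 1\<close>, where it excludes a negative first letter: for the signed permutation
  with one-letter word \<open>-1\<close>, whose code is \<open>-1\<close>, the set of left-to-right maximum places must
  be empty in order to agree with \<open>Rmil_B\<close> of the code.
\<close>

definition Lmap_B :: "nat \<Rightarrow> (int \<Rightarrow> int) \<Rightarrow> int set" where
  "Lmap_B n \<omega> = {i \<in> {1..int n}. 0 < \<omega> i \<and> (\<forall>j \<in> {1..<i}. \<bar>\<omega> j\<bar> < \<omega> i)}"

definition Rmil_B :: "nat \<Rightarrow> (int \<Rightarrow> int) \<Rightarrow> int set" where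
  "Rmil_B n \<omega> = {\<omega> i | i. i \<in> {1..int n} \<and> 0 < \<omega> i \<and> (\<forall>j \<in> {i<..int n}. \<omega> i < \<bar>\<omega> j\<bar>)}"

end

theory Submission
  imports Defs
begin

text \<open>
  Read \<open>b\<^sub>i\<close> as the first return of \<open>\<sigma>\<^sup>-\<^sup>1\<close>, started at \<open>i\<close>, to \<open>{-i..i}\<close>.
  Deleting \<open>\<plusminus>n\<close> from the cycles of \<open>\<sigma>\<close> does not affect first returns to smaller intervals, and
  the deletion is undone by composing with the transposition of \<open>\<plusminus>n\<close> and \<open>\<plusminus>b\<^sub>n\<close>; bijectivity
  follows by induction on \<open>n\<close>. The first return from \<open>i\<close> is \<open>\<plusminus>i\<close> exactly when \<open>i\<close> is minimal in
  its cycle of \<open>|\<sigma>|\<close>, with sign the product of the signs along that cycle. Finally, if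
  \<open>|x| \<le> |\<sigma> x|\<close>, then the code has \<open>\<plusminus>x\<close> at place \<open>|\<sigma> x|\<close>, whereas the code value \<open>y\<close> at place
  \<open>m\<close> satisfies \<open>\<sigma> y = m\<close> or \<open>m < |\<sigma> y|\<close>; comparing these gives the statement on \<open>Lmap\<close>.
\<close>

section \<open>Signed permutations\<close>

lemma signed_perms_permutes:
  "\<sigma> \<in> signed_perms n \<Longrightarrow> \<sigma> permutes ({- int n..int n} - {0})"
  by (simp add: signed_perms_def)

lemma signed_perms_permutation: "\<sigma> \<in> signed_perms n \<Longrightarrow> permutation \<sigma>"
  using signed_perms_permutes permutation_permutes by blast

text \<open>Off the support both \<open>i\<close> and \<open>- i\<close> are fixed, so oddness holds
  for every integer. In particular \<open>0\<close> is fixed, and later uses need no range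
  check.\<close>

lemma signed_perms_odd:
  assumes "\<sigma> \<in> signed_perms n"
  shows "\<sigma> (- i) = - \<sigma> i"
proof (cases "i \<in> {- int n..int n} - {0}")
  case False
  moreover from this have "- i \<notin> {- int n..int n} - {0}" by auto
  ultimately show ?thesis
    using permutes_not_in[OF signed_perms_permutes[OF assms]] by metis
qed (use assms in \<open>simp add: signed_perms_def\<close>)

lemma signed_permsI:
  assumes "\<sigma> permutes ({- int n..int n} - {0})" "\<And>i. \<sigma> (- i) = - \<sigma> i"
  shows "\<sigma> \<in> signed_perms n"
  using assms by (simp add: signed_perms_def)

lemma signed_perms_inv:
  assumes "\<sigma> \<in> signed_perms n"
  shows "inv \<sigma> \<in> signed_perms n"
proof (rule signed_permsI)
  show "inv \<sigma> permutes ({- int n..int n} - {0})"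
    using signed_perms_permutes[OF assms] by (rule permutes_inv)
  show "inv \<sigma> (- i) = - inv \<sigma> i" for i
    using permutes_inverses[OF signed_perms_permutes[OF assms]] signed_perms_odd[OF assms]
    by metis
qed

lemma signed_perms_abs:
  assumes "\<sigma> \<in> signed_perms n"
  shows "\<bar>\<sigma> \<bar>i\<bar>\<bar> = \<bar>\<sigma> i\<bar>"
  using signed_perms_odd[OF assms, of i] by (cases "i \<ge> 0") simp_all

lemma signed_perms_abs_range:
  assumes "\<sigma> \<in> signed_perms n" "\<bar>i\<bar> \<in> {1..int n}"
  shows "\<bar>\<sigma> i\<bar> \<in> {1..int n}"
proof -
  have "i \<in> {- int n..int n} - {0}" using assms(2) by auto
  then have "\<sigma> i \<in> {- int n..int n} - {0}"
    using permutes_in_image[OF signed_perms_permutes[OF assms(1)]] by blast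
  then show ?thesis by auto
qed

lemma signed_perms_abs_inj:
  assumes "\<sigma> \<in> signed_perms n" "\<bar>\<sigma> i\<bar> = \<bar>\<sigma> j\<bar>"
  shows "\<bar>i\<bar> = \<bar>j\<bar>"
proof -
  have "\<sigma> i = \<sigma> j \<or> \<sigma> i = \<sigma> (- j)"
    using assms(2) signed_perms_odd[OF assms(1)] by (simp add: abs_eq_iff)
  then show ?thesis
    using inj_eq[OF permutes_inj[OF signed_perms_permutes[OF assms(1)]]] by auto
qed

lemma funpow_odd:
  fixes f :: "int \<Rightarrow> int"
  assumes "\<And>i. f (- i) = - f i"
  shows "(f ^^ k) (- i) = - (f ^^ k) i"
  by (induction k) (simp_all add: assms)

lemma funpow_inv_cancel:
  assumes "bij f" "j \<le> k"
  shows "(inv f ^^ j) ((f ^^ k) x) = (f ^^ (k - j)) x"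
proof -
  have "(f ^^ k) x = (f ^^ j) ((f ^^ (k - j)) x)"
    using funpow_add[of j "k - j" f] assms(2) by (simp add: fun_eq_iff)
  moreover have "(inv f ^^ j) ((f ^^ j) y) = y" for y
    using inv_fn_o_fn_is_id[OF assms(1), of j] by (simp add: fun_eq_iff)
  ultimately show ?thesis by simp
qed

section \<open>The code as a first return\<close>

text \<open>The relation carries no exponent: composing with a transposition lengthens trajectories,
  and rule induction avoids counting the added steps. Membership is tested only after a step, so the
  start may itself lie in \<open>A\<close>.\<close>

inductive first_return :: "('a \<Rightarrow> 'a) \<Rightarrow> 'a set \<Rightarrow> 'a \<Rightarrow> 'a \<Rightarrow> bool" for f A where
  now: "f x \<in> A \<Longrightarrow> first_return f A x (f x)"
| later: "f x \<notin> A \<Longrightarrow> first_return f A (f x) y \<Longrightarrow> first_return f A x y"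

lemma first_return_unique:
  "first_return f A x y \<Longrightarrow> first_return f A x z \<Longrightarrow> y = z"
proof (induction rule: first_return.induct)
  case (now x)
  then show ?case by (auto elim: first_return.cases)
next
  case (later x y)
  from later.prems later.hyps(1) have "first_return f A (f x) z"
    by (auto elim: first_return.cases)
  then show ?case by (rule later.IH)
qed

lemma first_return_funpow:
  assumes "1 \<le> k" "(f ^^ k) x \<in> A" "\<And>j. 1 \<le> j \<Longrightarrow> j < k \<Longrightarrow> (f ^^ j) x \<notin> A"
  shows "first_return f A x ((f ^^ k) x)"
  using assms
proof (induction k arbitrary: x rule: dec_induct)
  case base
  then show ?case by (simp add: first_return.now)
next
  case (step k)
  have "first_return f A (f x) ((f ^^ k) (f x))"
  proof (rule step.IH)
    show "(f ^^ k) (f x) \<in> A" using step.prems(1) by (simp add: funpow_swap1)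
    show "(f ^^ j) (f x) \<notin> A" if "1 \<le> j" "j < k" for j
      using step.prems(2)[of "Suc j"] that by (simp add: funpow_swap1)
  qed
  moreover have "f x \<notin> A" using step.prems(2)[of 1] step.hyps by simp
  ultimately show ?case by (simp add: first_return.later funpow_swap1)
qed

lemma first_return_in: "first_return f A x y \<Longrightarrow> y \<in> A"
  by (induction rule: first_return.induct)

text \<open>All intermediate points avoid \<open>A\<close>, so the returned value can be undone by
  one step. This yields both nonvanishing of code values and \<open>B_code_preimage\<close>.\<close>

lemma first_return_last_step:
  "first_return f A x y \<Longrightarrow> \<exists>w. y = f w \<and> (w = x \<or> w \<notin> A)"
  by (induction rule: first_return.induct) auto

text \<open>The \<open>LEAST\<close> is meaningful because \<open>inv \<sigma>\<close> moves only
  finitely many points, so its iterates bring \<open>i\<close> back to itself.\<close>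

lemma code_exponent:
  assumes "\<sigma> \<in> signed_perms n" "i \<ge> 1"
  shows "code_exponent \<sigma> i \<ge> 1"
    and "\<bar>(inv \<sigma> ^^ code_exponent \<sigma> i) i\<bar> \<le> i"
    and "\<And>j. 1 \<le> j \<Longrightarrow> j < code_exponent \<sigma> i \<Longrightarrow> i < \<bar>(inv \<sigma> ^^ j) i\<bar>"
proof -
  have "i \<in> orbit (inv \<sigma>) i"
    using signed_perms_permutation[OF signed_perms_inv[OF assms(1)]]
    by (rule permutation_self_in_orbit)
  then obtain k where "k > 0" "(inv \<sigma> ^^ k) i = i"
    by (auto simp: orbit_altdef)
  then have "\<exists>k. k \<ge> 1 \<and> \<bar>(inv \<sigma> ^^ k) i\<bar> \<le> i"
    using assms(2) by (intro exI[of _ k]) auto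
  from LeastI_ex[OF this] show "code_exponent \<sigma> i \<ge> 1" "\<bar>(inv \<sigma> ^^ code_exponent \<sigma> i) i\<bar> \<le> i"
    by (simp_all add: code_exponent_def)
  show "i < \<bar>(inv \<sigma> ^^ j) i\<bar>" if "1 \<le> j" "j < code_exponent \<sigma> i" for j
    using not_less_Least[OF that(2)[unfolded code_exponent_def]] that(1) by simp
qed

lemma B_code_first_return:
  assumes "\<sigma> \<in> signed_perms n" "i \<in> {1..int n}"
  shows "first_return (inv \<sigma>) {- i..i} i (B_code n \<sigma> i)"
proof -
  have "i \<ge> 1" using assms(2) by simp
  note exponent = code_exponent[OF assms(1) this]
  have "first_return (inv \<sigma>) {- i..i} i ((inv \<sigma> ^^ code_exponent \<sigma> i) i)"
  proof (rule first_return_funpow[OF exponent(1)])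
    show "(inv \<sigma> ^^ code_exponent \<sigma> i) i \<in> {- i..i}" using exponent(2) by auto
    show "(inv \<sigma> ^^ j) i \<notin> {- i..i}" if "1 \<le> j" "j < code_exponent \<sigma> i" for j
      using exponent(3)[OF that] by auto
  qed
  then show ?thesis using assms(2) by (simp add: B_code_def)
qed

lemma B_code_eqI:
  assumes "\<sigma> \<in> signed_perms n" "i \<in> {1..int n}" "first_return (inv \<sigma>) {- i..i} i y"
  shows "B_code n \<sigma> i = y"
  using first_return_unique B_code_first_return[OF assms(1,2)] assms(3) by metis

lemma B_code_in_SE_B:
  assumes "\<sigma> \<in> signed_perms n"
  shows "B_code n \<sigma> \<in> SE_B n"
  unfolding SE_B_def
proof (rule PiE_I)
  fix i assume i: "i \<in> {1..int n}"
  have "inv \<sigma> x = 0 \<Longrightarrow> x = 0" for x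
    using signed_perms_abs_inj[OF signed_perms_inv[OF assms], of x 0]
      signed_perms_odd[OF signed_perms_inv[OF assms], of 0] by simp
  moreover obtain w where "B_code n \<sigma> i = inv \<sigma> w" "w = i \<or> w \<notin> {- i..i}"
    using first_return_last_step[OF B_code_first_return[OF assms i]] by blast
  \<comment> \<open>The point \<open>w\<close> is nonzero in both cases, since \<open>i\<close> is
    positive and \<open>{- i..i}\<close> contains \<open>0\<close>.\<close>
  ultimately have "B_code n \<sigma> i \<noteq> 0" using i by force
  then show "B_code n \<sigma> i \<in> {- i..i} - {0}"
    using first_return_in[OF B_code_first_return[OF assms i]] by simp
qed (auto simp: B_code_def restrict_def)

section \<open>Bijectivity\<close>

text \<open>For \<open>b = - m\<close> the order of the tests makes this the transposition of \<open>m\<close> and \<open>- m\<close>.\<close>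

definition signed_swap :: "int \<Rightarrow> int \<Rightarrow> int \<Rightarrow> int" where
  "signed_swap m b x =
    (if x = m then b else if x = - m then - b else if x = b then m else if x = - b then - m else x)"

lemma signed_swap_invol:
  "b \<noteq> 0 \<Longrightarrow> m \<noteq> 0 \<Longrightarrow> signed_swap m b (signed_swap m b x) = x"
  by (auto simp: signed_swap_def)

lemma signed_swap_in_signed_perms:
  assumes "\<bar>b\<bar> \<in> {1..int n}" "\<bar>m\<bar> \<in> {1..int n}"
  shows "signed_swap m b \<in> signed_perms n"
proof (rule signed_permsI)
  show "signed_swap m b permutes ({- int n..int n} - {0})"
  proof (rule bij_imp_permutes)
    show "bij_betw (signed_swap m b) ({- int n..int n} - {0}) ({- int n..int n} - {0})"
      using assms
      by (intro bij_betw_byWitness[where f' = "signed_swap m b"])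
        (auto simp: signed_swap_invol, auto simp: signed_swap_def split: if_splits)
  qed (use assms in \<open>auto simp: signed_swap_def\<close>)
  show "signed_swap m b (- i) = - signed_swap m b i" for i
    using assms by (auto simp: signed_swap_def)
qed

lemma signed_perms_comp:
  assumes "\<sigma> \<in> signed_perms n" "\<tau> \<in> signed_perms n"
  shows "\<sigma> \<circ> \<tau> \<in> signed_perms n"
proof (rule signed_permsI)
  show "\<sigma> \<circ> \<tau> permutes ({- int n..int n} - {0})"
    using assms by (intro permutes_compose signed_perms_permutes)
  show "(\<sigma> \<circ> \<tau>) (- i) = - (\<sigma> \<circ> \<tau>) i" for i
    using assms by (simp add: signed_perms_odd)
qed

lemma signed_perms_Suc: "signed_perms n \<subseteq> signed_perms (Suc n)"
proof
  fix \<sigma> assume \<sigma>: "\<sigma> \<in> signed_perms n"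
  show "\<sigma> \<in> signed_perms (Suc n)"
    by (rule signed_permsI)
      (auto intro: permutes_subset[OF signed_perms_permutes[OF \<sigma>]] simp: signed_perms_odd[OF \<sigma>])
qed

lemma signed_perms_delete:
  assumes \<sigma>: "\<sigma> \<in> signed_perms (Suc n)" and fixed: "\<sigma> (int (Suc n)) = int (Suc n)"
  shows "\<sigma> \<in> signed_perms n"
proof (rule signed_permsI)
  show "\<sigma> (- i) = - \<sigma> i" for i using \<sigma> by (rule signed_perms_odd)
  show "\<sigma> permutes ({- int n..int n} - {0})"
  proof (rule permutes_superset[OF signed_perms_permutes[OF \<sigma>]])
    fix x assume "x \<in> {- int (Suc n)..int (Suc n)} - {0} - ({- int n..int n} - {0})"
    then have "x = int (Suc n) \<or> x = - int (Suc n)" by auto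
    then show "\<sigma> x = x" using fixed signed_perms_odd[OF \<sigma>, of "int (Suc n)"]
      by (auto simp del: of_nat_Suc)
  qed
qed

lemma inv_comp_signed_swap:
  assumes "\<sigma> \<in> signed_perms n" "b \<noteq> 0" "m \<noteq> 0"
  shows "inv (\<sigma> \<circ> signed_swap m b) = signed_swap m b \<circ> inv \<sigma>"
  using permutes_inverses[OF signed_perms_permutes[OF assms(1)]]
  by (intro inv_unique_comp) (simp_all add: fun_eq_iff signed_swap_invol assms)

text \<open>The new map follows the trajectory of \<open>g\<close>, except that an arrival at
  \<open>b\<close> or \<open>- b\<close> is preceded by a visit to \<open>m\<close> or
  \<open>- m\<close>. These extra points lie outside \<open>A\<close>, so the first return is the
  same. If \<open>b\<close> is \<open>m\<close> or \<open>- m\<close>, no detour arises, as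
  \<open>g\<close> keeps the trajectory strictly below \<open>m\<close> in absolute value.\<close>

lemma first_return_signed_swap:
  assumes fr: "first_return g A x y"
    and g: "\<And>z. \<bar>z\<bar> < m \<Longrightarrow> \<bar>g z\<bar> < m" "g m = m" "g (- m) = - m"
    and A: "m \<notin> A" "- m \<notin> A"
    and "\<bar>x\<bar> < m" "b \<noteq> 0" "\<bar>b\<bar> \<le> m"
  shows "first_return (signed_swap m b \<circ> g) A x y"
proof -
  let ?f = "signed_swap m b \<circ> g"
  have detour: "?f z = g z \<or> ?f z \<notin> A \<and> ?f (?f z) = g z" if "\<bar>z\<bar> < m" for z
  proof -
    have "m > 0" using that by simp
    have neq: "g z \<noteq> m" "g z \<noteq> - m" using g(1)[OF that] by auto
    consider "g z = b" | "g z = - b" "g z \<noteq> b" | "g z \<noteq> b" "g z \<noteq> - b" by blast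
    then show ?thesis
    proof cases
      case 1
      then have "?f z = m" using neq by (simp add: signed_swap_def)
      then show ?thesis using 1 g(2) A by (simp add: signed_swap_def)
    next
      case 2
      then have "?f z = - m" using neq by (simp add: signed_swap_def)
      then show ?thesis using 2 g(3) A \<open>m > 0\<close> by (simp add: signed_swap_def)
    next
      case 3
      then show ?thesis using neq by (simp add: signed_swap_def)
    qed
  qed
  show ?thesis using fr \<open>\<bar>x\<bar> < m\<close>
  proof (induction rule: first_return.induct)
    case (now x)
    then show ?case using detour[of x] first_return.intros[of ?f] by metis
  next
    case (later x y)
    then have "first_return ?f A (g x) y" using g(1) by blast
    then show ?case
      using detour[OF later.prems] first_return.later[of ?f] later.hyps(1) by metis
  qed
qed

text \<open>Inserting the new largest letter appends \<open>b\<close> to the code. At places up to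
  \<open>n\<close> the interval misses \<open>m\<close> and \<open>- m\<close>, so first returns
  survive; at place \<open>m\<close> the first backward step already gives \<open>b\<close>.\<close>

lemma B_code_comp_signed_swap:
  assumes \<sigma>: "\<sigma> \<in> signed_perms n" and b: "\<bar>b\<bar> \<in> {1..int (Suc n)}"
  defines "m \<equiv> int (Suc n)"
  shows "B_code (Suc n) (\<sigma> \<circ> signed_swap m b) = (B_code n \<sigma>)(m := b)"
proof
  fix i
  let ?\<tau> = "\<sigma> \<circ> signed_swap m b"
  have \<tau>: "?\<tau> \<in> signed_perms (Suc n)"
    using \<sigma> signed_perms_Suc b unfolding m_def
    by (intro signed_perms_comp signed_swap_in_signed_perms) auto
  have inv\<tau>: "inv ?\<tau> = signed_swap m b \<circ> inv \<sigma>"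
    using b by (intro inv_comp_signed_swap[OF \<sigma>]) (auto simp: m_def)
  note inv\<sigma> = signed_perms_inv[OF \<sigma>]
  have fixed: "inv \<sigma> m = m" "inv \<sigma> (- m) = - m"
    using permutes_not_in[OF signed_perms_permutes[OF inv\<sigma>]] by (auto simp: m_def)
  consider "i \<in> {1..int n}" | "i = m" | "i \<notin> {1..int (Suc n)}"
    by (cases "i = m"; cases "i \<le> int n") (auto simp: m_def)
  then show "B_code (Suc n) ?\<tau> i = ((B_code n \<sigma>)(m := b)) i"
  proof cases
    case 1
    have "\<bar>inv \<sigma> z\<bar> < m" if "\<bar>z\<bar> < m" for z
    proof (cases "z = 0")
      case True
      then show ?thesis using signed_perms_odd[OF inv\<sigma>, of 0] that by simp
    next
      case False
      then have "\<bar>z\<bar> \<in> {1..int n}" using that by (auto simp: m_def)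
      then show ?thesis using signed_perms_abs_range[OF inv\<sigma>] by (force simp: m_def)
    qed
    then have "first_return (inv ?\<tau>) {- i..i} i (B_code n \<sigma> i)"
      unfolding inv\<tau> using 1 b fixed
      by (intro first_return_signed_swap B_code_first_return[OF \<sigma>]) (auto simp: m_def)
    then show ?thesis using B_code_eqI[OF \<tau>] 1 by (auto simp: m_def)
  next
    case 2
    have "inv ?\<tau> m = b" by (simp add: inv\<tau> fixed signed_swap_def)
    then have "first_return (inv ?\<tau>) {- m..m} m b"
      using first_return.now[of "inv ?\<tau>" m "{- m..m}"] b
      unfolding m_def[symmetric] by (simp add: abs_le_iff)
    then show ?thesis using B_code_eqI[OF \<tau>, of m] 2 by (auto simp: m_def)
  next
    case 3
    then show ?thesis by (auto simp: B_code_def m_def)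
  qed
qed

text \<open>The preimage of \<open>m\<close> is the choice of \<open>b\<close> for which the product
  with the transposition fixes \<open>m\<close>, and by oddness \<open>- m\<close>, so that both
  leave the support. Involutivity of the transposition restores \<open>\<sigma>\<close>.\<close>

lemma signed_perms_decompose:
  assumes \<sigma>: "\<sigma> \<in> signed_perms (Suc n)"
  defines "m \<equiv> int (Suc n)"
  defines "b \<equiv> inv \<sigma> m"
  shows "\<bar>b\<bar> \<in> {1..int (Suc n)}" "\<sigma> \<circ> signed_swap m b \<in> signed_perms n"
    "\<sigma> = \<sigma> \<circ> signed_swap m b \<circ> signed_swap m b"
proof -
  show b: "\<bar>b\<bar> \<in> {1..int (Suc n)}"
    unfolding b_def by (rule signed_perms_abs_range[OF signed_perms_inv[OF \<sigma>]]) (simp add: m_def)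
  have "\<sigma> b = m"
    using permutes_inverses[OF signed_perms_permutes[OF \<sigma>]] by (simp add: b_def)
  then have "(\<sigma> \<circ> signed_swap m b) (int (Suc n)) = int (Suc n)"
    by (simp add: m_def signed_swap_def)
  moreover have "\<sigma> \<circ> signed_swap m b \<in> signed_perms (Suc n)"
    using b by (intro signed_perms_comp \<sigma> signed_swap_in_signed_perms) (auto simp: m_def)
  ultimately show "\<sigma> \<circ> signed_swap m b \<in> signed_perms n" by (rule signed_perms_delete[rotated])
  have "b \<noteq> 0" "m \<noteq> 0" using b by (auto simp: m_def)
  then show "\<sigma> = \<sigma> \<circ> signed_swap m b \<circ> signed_swap m b"
    by (simp add: comp_def signed_swap_invol)
qed

text \<open>In the induction step both sides split into an object of size \<open>n\<close> and an
  admissible \<open>b\<close>, and the code respects this splitting.\<close>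

lemma B_code_bij: "bij_betw (B_code n) (signed_perms n) (SE_B n)"
proof (induction n)
  case 0
  have "signed_perms 0 = {id}" by (auto simp: signed_perms_def permutes_empty)
  moreover have "SE_B 0 = {\<lambda>_. undefined}" by (simp add: SE_B_def)
  ultimately show ?case by (auto simp: bij_betw_def B_code_def)
next
  case (Suc n)
  define m where "m = int (Suc n)"
  note swap = B_code_comp_signed_swap[of _ n, folded m_def]
  have undef: "B_code n \<sigma> m = undefined" for \<sigma> by (simp add: B_code_def m_def)
  have "inj_on (B_code (Suc n)) (signed_perms (Suc n))"
  proof (rule inj_onI)
    fix \<sigma> \<rho>
    assume \<sigma>: "\<sigma> \<in> signed_perms (Suc n)" and \<rho>: "\<rho> \<in> signed_perms (Suc n)"
      and eq: "B_code (Suc n) \<sigma> = B_code (Suc n) \<rho>"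
    note d\<sigma> = signed_perms_decompose[OF \<sigma>, folded m_def]
    note d\<rho> = signed_perms_decompose[OF \<rho>, folded m_def]
    define b where "b = inv \<sigma> m"
    define c where "c = inv \<rho> m"
    define \<sigma>' where "\<sigma>' = \<sigma> \<circ> signed_swap m b"
    define \<rho>' where "\<rho>' = \<rho> \<circ> signed_swap m c"
    note defs = b_def[symmetric] c_def[symmetric] \<sigma>'_def[symmetric] \<rho>'_def[symmetric]
    have codes: "(B_code n \<sigma>')(m := b) = (B_code n \<rho>')(m := c)"
      using eq swap[OF d\<sigma>(2,1)] swap[OF d\<rho>(2,1)] d\<sigma>(3) d\<rho>(3) unfolding defs by simp
    then have "b = c" by (meson fun_upd_eqD)
    \<comment> \<open>Both shorter codes have the default value \<open>undefined\<close> at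
      \<open>m\<close>, so overwriting that place loses no information.\<close>
    moreover have "B_code n \<sigma>' = B_code n \<rho>'"
      using codes undef by (metis fun_upd_triv fun_upd_upd)
    then have "\<sigma>' = \<rho>'"
      using Suc.IH d\<sigma>(2) d\<rho>(2) unfolding defs by (auto simp: bij_betw_def dest: inj_onD)
    ultimately show "\<sigma> = \<rho>" using d\<sigma>(3) d\<rho>(3) unfolding defs by simp
  qed
  moreover have "\<exists>\<sigma> \<in> signed_perms (Suc n). B_code (Suc n) \<sigma> = a" if a: "a \<in> SE_B (Suc n)" for a
  proof -
    have "a m \<in> {- m..m} - {0}" using a unfolding SE_B_def by (rule PiE_mem) (simp add: m_def)
    then have b: "\<bar>a m\<bar> \<in> {1..m}" by (auto simp: m_def)
    have "a(m := undefined) \<in> SE_B n"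
      using a by (auto simp: SE_B_def m_def PiE_iff extensional_def)
    then obtain \<sigma> where \<sigma>: "\<sigma> \<in> signed_perms n" "B_code n \<sigma> = a(m := undefined)"
      using Suc.IH unfolding bij_betw_def by (metis imageE)
    have "B_code (Suc n) (\<sigma> \<circ> signed_swap m (a m)) = a"
      using swap[OF \<sigma>(1) b] \<sigma>(2) by simp
    moreover have "\<sigma> \<circ> signed_swap m (a m) \<in> signed_perms (Suc n)"
      using \<sigma>(1) b
      by (intro signed_perms_comp[OF subsetD[OF signed_perms_Suc]] signed_swap_in_signed_perms)
        (auto simp: m_def)
    ultimately show ?thesis by blast
  qed
  ultimately show ?case
    using B_code_in_SE_B unfolding bij_betw_def by (intro conjI subset_antisym subsetI) auto
qed

section \<open>Balanced cycles\<close>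

lemma abs_perm_permutes:
  assumes \<sigma>: "\<sigma> \<in> signed_perms n"
  shows "abs_perm n \<sigma> permutes {1..int n}"
proof (rule bij_imp_permutes)
  have "inj_on (abs_perm n \<sigma>) {1..int n}"
  proof (rule inj_onI)
    fix i j assume "i \<in> {1..int n}" "j \<in> {1..int n}" "abs_perm n \<sigma> i = abs_perm n \<sigma> j"
    then show "i = j"
      using signed_perms_abs_inj[OF \<sigma>, of i j] by (simp add: abs_perm_def)
  qed
  moreover have "abs_perm n \<sigma> ` {1..int n} \<subseteq> {1..int n}"
  proof
    fix y assume "y \<in> abs_perm n \<sigma> ` {1..int n}"
    then obtain i where "i \<in> {1..int n}" "y = \<bar>\<sigma> i\<bar>" by (auto simp: abs_perm_def)
    then show "y \<in> {1..int n}" using signed_perms_abs_range[OF \<sigma>, of i] by simp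
  qed
  ultimately show "bij_betw (abs_perm n \<sigma>) {1..int n} {1..int n}"
    by (simp add: bij_betw_def endo_inj_surj)
qed (auto simp: abs_perm_def)

lemma abs_perm_funpow:
  assumes \<sigma>: "\<sigma> \<in> signed_perms n" and i: "i \<in> {1..int n}"
  shows "(abs_perm n \<sigma> ^^ k) i = \<bar>(\<sigma> ^^ k) i\<bar>" "(abs_perm n \<sigma> ^^ k) i \<in> {1..int n}"
proof (induction k)
  case 0
  { case 1 then show ?case using i by simp }
  { case 2 then show ?case using i by simp }
next
  case (Suc k)
  { case 1 then show ?case
      using Suc signed_perms_abs[OF \<sigma>] by (simp add: abs_perm_def) }
  { case 2 then show ?case
      using permutes_in_image[OF abs_perm_permutes[OF \<sigma>]] Suc.IH(2) by simp }
qed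

text \<open>By oddness each step from \<open>x\<close> multiplies the sign of \<open>x\<close> by
  that of \<open>\<sigma> \<bar>x\<bar>\<close>, so the sign after \<open>k\<close> steps depends
  only on the absolute values visited.\<close>

lemma sgn_funpow:
  assumes \<sigma>: "\<sigma> \<in> signed_perms n" and i: "i \<in> {1..int n}"
  shows "sgn ((\<sigma> ^^ k) i) = (\<Prod>j<k. sgn (\<sigma> ((abs_perm n \<sigma> ^^ j) i)))"
proof (induction k)
  case 0
  then show ?case using i by simp
next
  case (Suc k)
  let ?x = "(\<sigma> ^^ k) i"
  have "?x \<noteq> 0" using abs_perm_funpow[OF \<sigma> i, of k] by auto
  then have "sgn (\<sigma> ?x) = sgn ?x * sgn (\<sigma> \<bar>?x\<bar>)"
    using signed_perms_odd[OF \<sigma>, of ?x] by (cases "?x > 0") (simp_all add: sgn_minus)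
  then show ?case using Suc by (simp add: abs_perm_funpow(1)[OF \<sigma> i, of k])
qed

lemma prod_sgn_balanced:
  assumes "finite C" "\<And>x. x \<in> C \<Longrightarrow> \<sigma> x \<noteq> 0"
  shows "(\<Prod>x\<in>C. sgn (\<sigma> x)) = (if balanced \<sigma> C then 1 else - 1)"
proof -
  have "(\<Prod>x\<in>C. sgn (\<sigma> x)) = (\<Prod>x\<in>C. if \<sigma> x < 0 then - 1 else 1)"
    using assms(2) by (intro prod.cong) (auto simp: sgn_if)
  also have "\<dots> = (\<Prod>x\<in>{x \<in> C. \<sigma> x < 0}. - 1)"
    using assms(1) by (rule prod.inter_filter[symmetric])
  finally show ?thesis by (simp add: balanced_def)
qed

text \<open>One full turn around the cycle multiplies \<open>i\<close> by the product of its signs.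
  By minimality of \<open>i\<close>, all points met earlier have larger absolute value, so the first
  return occurs exactly after that turn.\<close>

lemma B_code_cycle_minimum:
  assumes \<sigma>: "\<sigma> \<in> signed_perms n" and i: "i \<in> {1..int n}"
  defines "C \<equiv> orbit (abs_perm n \<sigma>) i"
  assumes minimal: "\<And>x. x \<in> C \<Longrightarrow> i \<le> x"
  shows "B_code n \<sigma> i = (if balanced \<sigma> C then i else - i)"
proof -
  define p where "p = abs_perm n \<sigma>"
  \<comment> \<open>This is the length of the cycle: the least positive number of steps from
    \<open>i\<close> back to \<open>i\<close>.\<close>
  define d where "d = funpow_dist1 p i i"
  define e where "e = (if balanced \<sigma> C then 1 else - 1 :: int)"
  have p: "(p ^^ k) i = \<bar>(\<sigma> ^^ k) i\<bar>" "(p ^^ k) i \<in> {1..int n}" for k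
    unfolding p_def by (rule abs_perm_funpow[OF \<sigma> i])+
  have "permutation p"
    using abs_perm_permutes[OF \<sigma>] by (auto simp: p_def permutation_permutes)
  then have self: "i \<in> orbit p i" by (rule permutation_self_in_orbit)
  have C: "C = (\<lambda>j. (p ^^ j) i) ` {..<d}"
    using orbit_conv_funpow_dist1[OF self] by (simp add: C_def d_def p_def lessThan_atLeast0)
  have inj: "inj_on (\<lambda>j. (p ^^ j) i) {..<d}"
    using inj_on_funpow_dist1[OF self] by (simp add: d_def lessThan_atLeast0)
  have "\<sigma> x \<noteq> 0" if "x \<in> C" for x
  proof -
    have "x \<in> {1..int n}" using that p(2) unfolding C by blast
    then show ?thesis using signed_perms_abs_range[OF \<sigma>, of x] by auto
  qed
  then have "(\<Prod>x\<in>C. sgn (\<sigma> x)) = e"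
    unfolding e_def by (intro prod_sgn_balanced) (auto simp: C)
  then have "sgn ((\<sigma> ^^ d) i) = e"
    using sgn_funpow[OF \<sigma> i, of d, folded p_def]
    unfolding C prod.reindex[OF inj] by (simp only: comp_def)
  moreover have "\<bar>(\<sigma> ^^ d) i\<bar> = i"
    using funpow_dist1_prop[OF self, folded d_def] p(1) by metis
  ultimately have closed: "(\<sigma> ^^ d) i = e * i"
    by (metis mult.commute abs_mult_sgn)
  have bij: "bij \<sigma>" using signed_perms_permutes[OF \<sigma>] by (rule permutes_bij)
  \<comment> \<open>Since \<open>e\<close> is its own inverse, \<open>i\<close> equals
    \<open>e\<close> times its \<open>d\<close>-th iterate. Going back \<open>j\<close> steps thus
    turns backward iterates into forward ones, whose absolute values lie in
    \<open>C\<close>.\<close>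
  have unwind: "(inv \<sigma> ^^ j) i = e * (\<sigma> ^^ (d - j)) i" if "j \<le> d" for j
    using funpow_inv_cancel[OF bij that, of i] closed
      funpow_odd[of "inv \<sigma>" j i, OF signed_perms_odd[OF signed_perms_inv[OF \<sigma>]]]
    by (auto simp: e_def split: if_splits)
  have "code_exponent \<sigma> i = d"
    unfolding code_exponent_def
  proof (rule Least_equality)
    have "1 \<le> d" by (simp add: d_def)
    then show "1 \<le> d \<and> \<bar>(inv \<sigma> ^^ d) i\<bar> \<le> i"
      using unwind[of d] i by (simp add: e_def)
    show "d \<le> j" if j: "1 \<le> j \<and> \<bar>(inv \<sigma> ^^ j) i\<bar> \<le> i" for j
    proof (rule ccontr)
      assume "\<not> d \<le> j"
      then have "(p ^^ (d - j)) i \<le> i"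
        using j unwind[of j] p(1)[of "d - j"] by (auto simp: e_def split: if_splits)
      moreover have "i \<le> (p ^^ (d - j)) i"
        using j \<open>\<not> d \<le> j\<close> by (intro minimal) (simp add: C)
      moreover have "(p ^^ (d - j)) i \<noteq> i"
        using funpow_dist1_least[of "d - j" p i i] j \<open>\<not> d \<le> j\<close> by (simp add: d_def)
      ultimately show False by simp
    qed
  qed
  then show ?thesis using i unwind[of d] by (simp add: B_code_def e_def)
qed

text \<open>This is the converse direction. The trajectory closes after \<open>k\<close> steps, with
  \<open>k\<close> the code exponent, so its first \<open>k\<close> points give the whole orbit in
  absolute value. Each one but the start is also a backward iterate before the first return, hence
  larger than \<open>i\<close> in absolute value.\<close>

lemma B_code_fixed_minimal:
  assumes \<sigma>: "\<sigma> \<in> signed_perms n" and i: "i \<in> {1..int n}" and fixed: "B_code n \<sigma> i = i"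
    and x: "x \<in> orbit (abs_perm n \<sigma>) i"
  shows "i \<le> x"
proof -
  define k where "k = code_exponent \<sigma> i"
  have "i \<ge> 1" using i by simp
  note exponent = code_exponent[OF \<sigma> this, folded k_def]
  have bij: "bij \<sigma>" using signed_perms_permutes[OF \<sigma>] by (rule permutes_bij)
  have "(inv \<sigma> ^^ k) i = i" using fixed i by (simp add: B_code_def k_def)
  then have closed: "(\<sigma> ^^ k) i = i"
    using fun_cong[OF fn_o_inv_fn_is_id[OF bij, of k], of i] by simp
  then have "(abs_perm n \<sigma> ^^ k) i = i" using abs_perm_funpow(1)[OF \<sigma> i] i by simp
  then obtain l where l: "l < k" "x = (abs_perm n \<sigma> ^^ l) i"
    using orbit_altdef_bounded[of k "abs_perm n \<sigma>" i] exponent(1) x by auto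
  show ?thesis
  proof (cases "l = 0")
    case False
    have "(inv \<sigma> ^^ (k - l)) i = (\<sigma> ^^ l) i"
      using funpow_inv_cancel[OF bij, of "k - l" k i] closed l(1) by simp
    then have "x = \<bar>(inv \<sigma> ^^ (k - l)) i\<bar>"
      using l(2) abs_perm_funpow(1)[OF \<sigma> i] by simp
    then show ?thesis using exponent(3)[of "k - l"] l(1) False by fastforce
  qed (use l in simp)
qed

lemma Cyc_B_eq_Max_set:
  assumes \<sigma>: "\<sigma> \<in> signed_perms n"
  shows "Cyc_B n \<sigma> = Max_set n (B_code n \<sigma>)"
proof -
  let ?orb = "orbit (abs_perm n \<sigma>)"
  note p = abs_perm_permutes[OF \<sigma>]
  have self: "i \<in> ?orb i" for i
    using p by (intro permutation_self_in_orbit) (auto simp: permutation_permutes)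
  have fin: "finite (?orb i)" for i using self by (rule finite_orbit)
  show ?thesis
  proof (intro subset_antisym subsetI)
    fix i assume "i \<in> Cyc_B n \<sigma>"
    then obtain x where x: "x \<in> {1..int n}" "balanced \<sigma> (?orb x)" "i = Min (?orb x)"
      by (auto simp: Cyc_B_def abs_cycles_def)
    have mem: "i \<in> ?orb x" unfolding x(3) by (rule Min_in[OF fin orbit_nonempty])
    \<comment> \<open>The cycle is based anew at its own minimum, as
      \<open>B_code_cycle_minimum\<close> requires.\<close>
    have orb: "?orb i = ?orb x"
      by (rule orbit_cyclic_eq3[OF cyclic_on_orbit[OF p] mem]) simp
    have i: "i \<in> {1..int n}" using permutes_orbit_subset[OF p x(1)] mem by (rule subsetD)
    have "B_code n \<sigma> i = i"
      using B_code_cycle_minimum[OF \<sigma> i] x(2,3) Min_le[OF fin] orb by simp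
    then show "i \<in> Max_set n (B_code n \<sigma>)" using i by (simp add: Max_set_def)
  next
    fix i assume "i \<in> Max_set n (B_code n \<sigma>)"
    then have i: "i \<in> {1..int n}" and fixed: "B_code n \<sigma> i = i" by (auto simp: Max_set_def)
    note minimal = B_code_fixed_minimal[OF \<sigma> i fixed]
    \<comment> \<open>An unbalanced cycle would give the code value \<open>- i\<close>, which
      differs from \<open>i\<close> because \<open>i\<close> is positive.\<close>
    have "balanced \<sigma> (?orb i)"
      using B_code_cycle_minimum[OF \<sigma> i minimal] fixed i by (auto split: if_splits)
    moreover have "Min (?orb i) = i" using fin minimal self by (intro Min_eqI)
    ultimately show "i \<in> Cyc_B n \<sigma>"
      using i unfolding Cyc_B_def abs_cycles_def by (intro image_eqI[of _ _ "?orb i"]) auto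
  qed
qed

section \<open>Left-to-right maxima\<close>

text \<open>A single backward step from \<open>\<bar>\<sigma> x\<bar>\<close> reaches
  \<open>x\<close> or \<open>- x\<close>, already within the interval. The factor
  \<open>sgn (\<sigma> x)\<close> selects the preimage of the positive value.\<close>

lemma B_code_at_excedance:
  assumes \<sigma>: "\<sigma> \<in> signed_perms n" and x: "\<bar>x\<bar> \<in> {1..int n}" "\<bar>x\<bar> \<le> \<bar>\<sigma> x\<bar>"
  shows "B_code n \<sigma> \<bar>\<sigma> x\<bar> = sgn (\<sigma> x) * x"
proof (rule B_code_eqI[OF \<sigma>])
  let ?m = "\<bar>\<sigma> x\<bar>"
  show m: "?m \<in> {1..int n}" using signed_perms_abs_range[OF \<sigma> x(1)] .
  have "\<sigma> (sgn (\<sigma> x) * x) = ?m"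
    using m signed_perms_odd[OF \<sigma>, of x] by (cases "\<sigma> x > 0") (simp_all add: sgn_if)
  then have "inv \<sigma> ?m = sgn (\<sigma> x) * x"
    using permutes_inverses(2)[OF signed_perms_permutes[OF \<sigma>]] by metis
  moreover have "sgn (\<sigma> x) * x \<in> {- ?m..?m}"
    using x(2) by (auto simp: sgn_if)
  ultimately show "first_return (inv \<sigma>) {- ?m..?m} ?m (sgn (\<sigma> x) * x)"
    using first_return.now[of "inv \<sigma>" ?m] by simp
qed

lemma B_code_preimage:
  assumes \<sigma>: "\<sigma> \<in> signed_perms n" and m: "m \<in> {1..int n}"
  shows "\<sigma> (B_code n \<sigma> m) = m \<or> m < \<bar>\<sigma> (B_code n \<sigma> m)\<bar>"
proof -
  obtain w where "B_code n \<sigma> m = inv \<sigma> w" "w = m \<or> w \<notin> {- m..m}"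
    using first_return_last_step[OF B_code_first_return[OF \<sigma> m]] by blast
  then show ?thesis
    using permutes_inverses(1)[OF signed_perms_permutes[OF \<sigma>]] by auto
qed

text \<open>A maximum place \<open>i\<close> is matched with the occurrence of the letter
  \<open>i\<close> at place \<open>\<sigma> i\<close> of the code.\<close>

lemma Lmap_B_eq_Rmil_B:
  assumes \<sigma>: "\<sigma> \<in> signed_perms n"
  shows "Lmap_B n (word n \<sigma>) = Rmil_B n (B_code n \<sigma>)"
proof (intro subset_antisym subsetI)
  let ?b = "B_code n \<sigma>"
  fix i assume "i \<in> Lmap_B n (word n \<sigma>)"
  then have i: "i \<in> {1..int n}" "0 < \<sigma> i" and left: "\<And>j. 1 \<le> j \<Longrightarrow> j < i \<Longrightarrow> \<bar>\<sigma> j\<bar> < \<sigma> i"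
    by (auto simp: Lmap_B_def word_def)
  \<comment> \<open>Pigeonhole: \<open>i\<close> distinct absolute values fit below
    \<open>\<sigma> i\<close>, which forces \<open>i \<le> \<sigma> i\<close> and makes the
    excedance lemma applicable.\<close>
  have "(\<lambda>j. \<bar>\<sigma> j\<bar>) ` {1..i} \<subseteq> {1..\<sigma> i}"
  proof
    fix y assume "y \<in> (\<lambda>j. \<bar>\<sigma> j\<bar>) ` {1..i}"
    then obtain j where j: "j \<in> {1..i}" "y = \<bar>\<sigma> j\<bar>" by blast
    then have "1 \<le> y" using signed_perms_abs_range[OF \<sigma>, of j] i by auto
    moreover have "y \<le> \<sigma> i" using j left[of j] i by (cases "j = i") auto
    ultimately show "y \<in> {1..\<sigma> i}" by simp
  qed
  moreover have "inj_on (\<lambda>j. \<bar>\<sigma> j\<bar>) {1..i}"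
  proof (rule inj_onI)
    fix j k assume "j \<in> {1..i}" "k \<in> {1..i}" "\<bar>\<sigma> j\<bar> = \<bar>\<sigma> k\<bar>"
    then show "j = k" using signed_perms_abs_inj[OF \<sigma>, of j k] by simp
  qed
  ultimately have "card {1..i} \<le> card {1..\<sigma> i}" by (intro card_inj_on_le) auto
  then have "i \<le> \<sigma> i" using i by simp
  then have "?b (\<sigma> i) = i" using B_code_at_excedance[OF \<sigma>, of i] i by simp
  moreover have "i < \<bar>?b j\<bar>" if j: "j \<in> {\<sigma> i<..int n}" for j
  proof (rule ccontr)
    assume "\<not> i < \<bar>?b j\<bar>"
    have j': "j \<in> {1..int n}" using j i by simp
    have "?b j \<noteq> 0" using B_code_in_SE_B[OF \<sigma>] j' by (auto simp: SE_B_def)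
    then have "1 \<le> \<bar>?b j\<bar>" by linarith
    \<comment> \<open>A later code letter of absolute value at most \<open>i\<close> would have its
      image bounded by \<open>\<sigma> i < j\<close>, whereas \<open>B_code_preimage\<close> makes
      that image at least \<open>j\<close> in absolute value.\<close>
    then have "\<bar>\<sigma> \<bar>?b j\<bar>\<bar> \<le> \<sigma> i"
      using left[of "\<bar>?b j\<bar>"] \<open>\<not> i < \<bar>?b j\<bar>\<close> i by (cases "\<bar>?b j\<bar> = i") auto
    then show False
      using B_code_preimage[OF \<sigma> j'] signed_perms_abs[OF \<sigma>] j by auto
  qed
  moreover have "\<sigma> i \<in> {1..int n}" using signed_perms_abs_range[OF \<sigma>, of i] i by simp
  ultimately show "i \<in> Rmil_B n ?b"
    using i unfolding Rmil_B_def by (intro CollectI exI[of _ "\<sigma> i"]) auto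
next
  let ?b = "B_code n \<sigma>"
  fix i assume "i \<in> Rmil_B n ?b"
  then obtain m where m: "m \<in> {1..int n}" "i = ?b m" "0 < i"
    and right: "\<And>j. m < j \<Longrightarrow> j \<le> int n \<Longrightarrow> i < \<bar>?b j\<bar>"
    by (auto simp: Rmil_B_def)
  have "i \<le> m" using B_code_in_SE_B[OF \<sigma>] m by (auto simp: SE_B_def)
  then have i: "i \<in> {1..int n}" using m by simp
  \<comment> \<open>Otherwise place \<open>\<bar>\<sigma> j\<bar>\<close>, to the right of
    \<open>m\<close>, would carry \<open>j\<close> or \<open>- j\<close>, contradicting that
    \<open>i\<close> is smaller than all later letters in absolute value.\<close>
  have bound: "\<bar>\<sigma> j\<bar> \<le> m" if "1 \<le> j" "j \<le> i" for j
  proof (rule ccontr)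
    assume "\<not> \<bar>\<sigma> j\<bar> \<le> m"
    then have "\<bar>?b \<bar>\<sigma> j\<bar>\<bar> \<le> j"
      using B_code_at_excedance[OF \<sigma>, of j] that \<open>i \<le> m\<close> i by (auto simp: abs_mult sgn_if)
    moreover have "\<bar>\<sigma> j\<bar> \<le> int n" using signed_perms_abs_range[OF \<sigma>, of j] that i by simp
    ultimately show False using right[of "\<bar>\<sigma> j\<bar>"] \<open>\<not> \<bar>\<sigma> j\<bar> \<le> m\<close> that by simp
  qed
  \<comment> \<open>The case \<open>j = i\<close> of the bound rules out the second alternative for
    the preimage.\<close>
  have "\<sigma> i = m" using B_code_preimage[OF \<sigma> m(1)] bound[of i] m i by auto
  moreover have "\<bar>\<sigma> j\<bar> < m" if "1 \<le> j" "j < i" for j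
    using bound[of j] signed_perms_abs_inj[OF \<sigma>, of j i] \<open>\<sigma> i = m\<close> that m(3) by fastforce
  ultimately show "i \<in> Lmap_B n (word n \<sigma>)"
    using i m by (auto simp: Lmap_B_def word_def)
qed

theorem theorem3p4:
  fixes n :: nat
  assumes "n \<ge> 1"
  shows "bij_betw (B_code n) (signed_perms n) (SE_B n) \<and>
    (\<forall>\<sigma> \<in> signed_perms n.
       Cyc_B n \<sigma> = Max_set n (B_code n \<sigma>) \<and>
       Lmap_B n (word n \<sigma>) = Rmil_B n (B_code n \<sigma>))"
  using B_code_bij Cyc_B_eq_Max_set Lmap_B_eq_Rmil_B by blast

end
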